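(* Let $(f_n)_{n\ge 0}$ be a sequence in $L^2(\mathbb{T})$ and write $f_n=f_n^+e_++f_n^-e_-$ with $f_n^\pm\in L^2(\mathbb{C}^2)$. Then $(f_n)_n$ is a bc-frame for $L^2(\mathbb{T})$ with best frame bounds $A$ and $B$ if and only if its component sequences $(f_n^+)_n$ and $(f_n^-)_n$ are both frames for $L^2(\mathbb{C}^2)$, with best frame bounds $a^+,b^+$ and $a^-,b^-$ respectively. Moreover, $A=\min\{a^+,a^-\}$ and $B=\max\{b^+,b^-\}$.
   Context: Bicomplex numbers: $\mathbb{T}=\{z_1+jz_2: z_1,z_2\in\mathbb{C}\}$, where $\mathbb{C}=\mathbb{C}_i$, $j^2=-1$, $ij=ji$ (a commutative algebra). Put $e_\pm=\frac{1\pm ij}{2}$; then $e_\pm^2=e_\pm$, $e_+e_-=0$, $e_++e_-=1$, and every $Z\in\mathbb{T}$ is uniquely $Z=\alpha e_++\beta e_-$ with $\alpha,\beta\in\mathbb{C}$. Put $Z^*=\overline{\alpha}e_++\overline{\beta}e_-$ and $|Z|_{bc}^2=|z_1|^2+|z_2|^2=\frac12(|\alpha|^2+|\beta|^2)$. The bicomplex Hilbert space $L^2(\mathbb{T})$ consists of the (classes of) measurable functions $f:\mathbb{T}\to\mathbb{T}$, $f=f^+e_++f^-e_-$, with $f^\pm\in L^2(\mathbb{C}^2)$ (Lebesgue measure, $f^\pm$ being complex-valued functions of $(z_1,z_2)$). Its $\mathbb{T}$-valued inner product and norm are $\langle f,g\rangle_{bc}=\langle f^+,g^+\rangle_{L^2(\mathbb{C}^2)}e_++\langle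 f^-,g^-\rangle_{L^2(\mathbb{C}^2)}e_-$ and $\|f\|_{bc}^2=\frac12\left(\|f^+\|^2+\|f^-\|^2\right)$. A sequence $(f_n)_{n\ge0}$ is a bc-frame for $L^2(\mathbb{T})$ if there are constants $0<A\le B$ (frame bounds) such that $A\|f\|_{bc}^2\le\sum_{n=0}^\infty|\langle f,f_n\rangle_{bc}|_{bc}^2\le B\|f\|_{bc}^2$ for every $f\in L^2(\mathbb{T})$. The best frame bounds are the largest possible $A$ and the smallest possible $B$; similarly for ordinary frames in the complex Hilbert space $L^2(\mathbb{C}^2)$. *)

theory Defs
  imports "HOL-Analysis.Analysis"
begin

section \<open>Bicomplex numbers\<close>

datatype bicomplex = Bicomplex (bc_fst: complex) (bc_snd: complex)

instantiation bicomplex :: comm_ring_1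
begin

definition "0 = Bicomplex 0 0"
definition "1 = Bicomplex 1 0"
definition "Z + W = Bicomplex (bc_fst Z + bc_fst W) (bc_snd Z + bc_snd W)"
definition "- Z = Bicomplex (- bc_fst Z) (- bc_snd Z)"
definition "Z - W = Bicomplex (bc_fst Z - bc_fst W) (bc_snd Z - bc_snd W)"
definition "Z * W = Bicomplex (bc_fst Z * bc_fst W - bc_snd Z * bc_snd W)
                              (bc_fst Z * bc_snd W + bc_snd Z * bc_fst W)"

instance
  by standard
    (auto simp: zero_bicomplex_def one_bicomplex_def plus_bicomplex_def uminus_bicomplex_def
      minus_bicomplex_def times_bicomplex_def algebra_simps)

end

lemmas bicomplex_defs = zero_bicomplex_def one_bicomplex_def plus_bicomplex_def
  uminus_bicomplex_def minus_bicomplex_def times_bicomplex_def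

definition bc_of_complex :: "complex \<Rightarrow> bicomplex" where
  "bc_of_complex z = Bicomplex z 0"

definition bc_j :: bicomplex where
  "bc_j = Bicomplex 0 1"

definition e_plus :: bicomplex where
  "e_plus = bc_of_complex (1/2) * (1 + bc_of_complex \<i> * bc_j)"

definition e_minus :: bicomplex where
  "e_minus = bc_of_complex (1/2) * (1 - bc_of_complex \<i> * bc_j)"

lemmas bicomplex_const_defs = bc_of_complex_def bc_j_def e_plus_def e_minus_def

lemma bicomplex_eq: "Bicomplex z1 z2 = bc_of_complex z1 + bc_j * bc_of_complex z2"
  by (simp add: bicomplex_defs bicomplex_const_defs)

lemma bc_j_squared: "bc_j * bc_j = -1"
  by (simp add: bicomplex_defs bicomplex_const_defs)

lemma e_plus_idem: "e_plus * e_plus = e_plus"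
  and e_minus_idem: "e_minus * e_minus = e_minus"
  and e_plus_e_minus: "e_plus * e_minus = 0"
  and e_plus_plus_e_minus: "e_plus + e_minus = 1"
  by (simp_all add: bicomplex_defs bicomplex_const_defs)

text \<open>
  The coefficients \<open>\<alpha>\<close> and \<open>\<beta>\<close> in \<open>Z = \<alpha> e\<^sub>+ + \<beta> e\<^sub>-\<close>. The closed forms come from solving
  \<open>z\<^sub>1 = (\<alpha> + \<beta>) / 2\<close>, \<open>z\<^sub>2 = \<i> (\<alpha> - \<beta>) / 2\<close>; lemma \<open>bc_decomp_iff\<close> shows that they are
  the unique coefficients.
\<close>

definition bc_plus :: "bicomplex \<Rightarrow> complex" where
  "bc_plus Z = bc_fst Z - \<i> * bc_snd Z"

definition bc_minus :: "bicomplex \<Rightarrow> complex" where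
  "bc_minus Z = bc_fst Z + \<i> * bc_snd Z"

lemma bc_decomp_iff:
  "Z = bc_of_complex \<alpha> * e_plus + bc_of_complex \<beta> * e_minus \<longleftrightarrow>
     \<alpha> = bc_plus Z \<and> \<beta> = bc_minus Z"
proof (cases Z)
  case (Bicomplex z1 z2)
  have rhs: "bc_of_complex \<alpha> * e_plus + bc_of_complex \<beta> * e_minus =
      Bicomplex ((\<alpha> + \<beta>) / 2) (\<i> * (\<alpha> - \<beta>) / 2)"
    by (simp add: bicomplex_defs bicomplex_const_defs field_simps)
  show ?thesis
    unfolding rhs Bicomplex bc_plus_def bc_minus_def
    by (auto simp: field_simps complex_eq_iff)
qed

definition bc_mod :: "bicomplex \<Rightarrow> real" where
  "bc_mod Z = sqrt ((cmod (bc_fst Z))\<^sup>2 + (cmod (bc_snd Z))\<^sup>2)"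

lemma bc_mod_squared: "(bc_mod Z)\<^sup>2 = ((cmod (bc_plus Z))\<^sup>2 + (cmod (bc_minus Z))\<^sup>2) / 2"
proof -
  have "(bc_mod Z)\<^sup>2 = (cmod (bc_fst Z))\<^sup>2 + (cmod (bc_snd Z))\<^sup>2"
    by (simp add: bc_mod_def)
  then show ?thesis
    unfolding bc_plus_def bc_minus_def cmod_power2
    by (simp add: power2_eq_square algebra_simps)
qed


section \<open>The Hilbert space of square-integrable functions of two complex variables\<close>

text \<open>
  Elements are represented by functions rather than by classes modulo null sets; inner
  products, norms and hence all frame conditions depend only on the class.
\<close>

definition L2_C2 :: "(complex \<times> complex \<Rightarrow> complex) set" where
  "L2_C2 = {g. g \<in> borel_measurable lebesgue \<and> integrable lebesgue (\<lambda>z. (cmod (g z))\<^sup>2)}"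

definition L2_inner :: "(complex \<times> complex \<Rightarrow> complex) \<Rightarrow> (complex \<times> complex \<Rightarrow> complex) \<Rightarrow> complex"
  where "L2_inner g h = (LINT z|lebesgue. g z * cnj (h z))"

definition L2_norm :: "(complex \<times> complex \<Rightarrow> complex) \<Rightarrow> real" where
  "L2_norm g = sqrt (LINT z|lebesgue. (cmod (g z))\<^sup>2)"

text \<open>
  Summability is stated explicitly because \<open>suminf\<close> is unspecified on divergent series; for
  nonnegative terms it is what the finite upper bound expresses.
\<close>

definition frame_bounds :: "(nat \<Rightarrow> complex \<times> complex \<Rightarrow> complex) \<Rightarrow> real \<Rightarrow> real \<Rightarrow> bool" where
  "frame_bounds f A B \<longleftrightarrow>
     (\<forall>n. f n \<in> L2_C2) \<and> 0 < A \<and> A \<le> B \<and>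
     (\<forall>g\<in>L2_C2.
        summable (\<lambda>n. (cmod (L2_inner g (f n)))\<^sup>2) \<and>
        A * (L2_norm g)\<^sup>2 \<le> (\<Sum>n. (cmod (L2_inner g (f n)))\<^sup>2) \<and>
        (\<Sum>n. (cmod (L2_inner g (f n)))\<^sup>2) \<le> B * (L2_norm g)\<^sup>2)"

definition is_frame :: "(nat \<Rightarrow> complex \<times> complex \<Rightarrow> complex) \<Rightarrow> bool" where
  "is_frame f \<longleftrightarrow> (\<exists>A B. frame_bounds f A B)"

definition best_frame_bounds :: "(nat \<Rightarrow> complex \<times> complex \<Rightarrow> complex) \<Rightarrow> real \<Rightarrow> real \<Rightarrow> bool" where
  "best_frame_bounds f A B \<longleftrightarrow>
     frame_bounds f A B \<and> (\<forall>A' B'. frame_bounds f A' B' \<longrightarrow> A' \<le> A \<and> B \<le> B')"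


section \<open>The bicomplex Hilbert space\<close>

definition fun_plus :: "(bicomplex \<Rightarrow> bicomplex) \<Rightarrow> complex \<times> complex \<Rightarrow> complex" where
  "fun_plus f = (\<lambda>(z1, z2). bc_plus (f (Bicomplex z1 z2)))"

definition fun_minus :: "(bicomplex \<Rightarrow> bicomplex) \<Rightarrow> complex \<times> complex \<Rightarrow> complex" where
  "fun_minus f = (\<lambda>(z1, z2). bc_minus (f (Bicomplex z1 z2)))"

text \<open>Measurability of \<open>f\<close> itself is the same as that of both components.\<close>

definition L2_bc :: "(bicomplex \<Rightarrow> bicomplex) set" where
  "L2_bc = {f. fun_plus f \<in> L2_C2 \<and> fun_minus f \<in> L2_C2}"

definition bc_inner :: "(bicomplex \<Rightarrow> bicomplex) \<Rightarrow> (bicomplex \<Rightarrow> bicomplex) \<Rightarrow> bicomplex" where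
  "bc_inner f g =
     bc_of_complex (L2_inner (fun_plus f) (fun_plus g)) * e_plus +
     bc_of_complex (L2_inner (fun_minus f) (fun_minus g)) * e_minus"

definition bc_norm :: "(bicomplex \<Rightarrow> bicomplex) \<Rightarrow> real" where
  "bc_norm f = sqrt (((L2_norm (fun_plus f))\<^sup>2 + (L2_norm (fun_minus f))\<^sup>2) / 2)"

definition bc_frame_bounds :: "(nat \<Rightarrow> bicomplex \<Rightarrow> bicomplex) \<Rightarrow> real \<Rightarrow> real \<Rightarrow> bool" where
  "bc_frame_bounds f A B \<longleftrightarrow>
     (\<forall>n. f n \<in> L2_bc) \<and> 0 < A \<and> A \<le> B \<and>
     (\<forall>g\<in>L2_bc.
        summable (\<lambda>n. (bc_mod (bc_inner g (f n)))\<^sup>2) \<and>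
        A * (bc_norm g)\<^sup>2 \<le> (\<Sum>n. (bc_mod (bc_inner g (f n)))\<^sup>2) \<and>
        (\<Sum>n. (bc_mod (bc_inner g (f n)))\<^sup>2) \<le> B * (bc_norm g)\<^sup>2)"

definition is_bc_frame :: "(nat \<Rightarrow> bicomplex \<Rightarrow> bicomplex) \<Rightarrow> bool" where
  "is_bc_frame f \<longleftrightarrow> (\<exists>A B. bc_frame_bounds f A B)"

definition best_bc_frame_bounds :: "(nat \<Rightarrow> bicomplex \<Rightarrow> bicomplex) \<Rightarrow> real \<Rightarrow> real \<Rightarrow> bool" where
  "best_bc_frame_bounds f A B \<longleftrightarrow>
     bc_frame_bounds f A B \<and> (\<forall>A' B'. bc_frame_bounds f A' B' \<longrightarrow> A' \<le> A \<and> B \<le> B')"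

end

theory Submission
  imports Defs
begin

text \<open>
  The idempotent decomposition turns both the bicomplex norm and the bicomplex frame sum into the
  average of the two component quantities. Testing with functions one of whose components vanishes,
  \<open>(A, B)\<close> is a pair of bc-frame bounds iff it is a pair of frame bounds for both components.
  Since \<open>L\<^sup>2(\<complex>\<^sup>2)\<close> is nontrivial, the lower bounds of a frame lie below its upper bounds,
  so best bounds exist as a supremum and an infimum, and all pairs of frame bounds are those
  enclosing the best pair. Intersecting the two enclosing conditions yields \<open>min\<close> and \<open>max\<close>.
\<close>

section \<open>Idempotent components of bicomplex functions\<close>

lemma bc_plus_decomp [simp]:
  "bc_plus (bc_of_complex \<alpha> * e_plus + bc_of_complex \<beta> * e_minus) = \<alpha>"
  using bc_decomp_iff by metis

lemma bc_minus_decomp [simp]: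
  "bc_minus (bc_of_complex \<alpha> * e_plus + bc_of_complex \<beta> * e_minus) = \<beta>"
  using bc_decomp_iff by metis

lemma bc_mod_bc_inner_squared:
  "(bc_mod (bc_inner g h))\<^sup>2 =
     ((cmod (L2_inner (fun_plus g) (fun_plus h)))\<^sup>2 +
      (cmod (L2_inner (fun_minus g) (fun_minus h)))\<^sup>2) / 2"
  by (simp add: bc_mod_squared bc_inner_def)

lemma bc_norm_squared:
  "(bc_norm g)\<^sup>2 = ((L2_norm (fun_plus g))\<^sup>2 + (L2_norm (fun_minus g))\<^sup>2) / 2"
  by (simp add: bc_norm_def)

text \<open>Inverse to the pair (\<open>fun_plus\<close>, \<open>fun_minus\<close>). It supplies
  test functions with prescribed components, one of which will be zero.\<close>

definition bc_fun :: "(complex \<times> complex \<Rightarrow> complex) \<Rightarrow> (complex \<times> complex \<Rightarrow> complex) \<Rightarrow>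
    bicomplex \<Rightarrow> bicomplex" where
  "bc_fun g h = (\<lambda>Z. bc_of_complex (g (bc_fst Z, bc_snd Z)) * e_plus +
                     bc_of_complex (h (bc_fst Z, bc_snd Z)) * e_minus)"

lemma fun_plus_bc_fun [simp]: "fun_plus (bc_fun g h) = g"
  by (simp add: fun_plus_def bc_fun_def fun_eq_iff)

lemma fun_minus_bc_fun [simp]: "fun_minus (bc_fun g h) = h"
  by (simp add: fun_minus_def bc_fun_def fun_eq_iff)

section \<open>Test functions in the complex Hilbert space\<close>

lemma zero_in_L2_C2: "(\<lambda>_. 0) \<in> L2_C2"
  by (simp add: L2_C2_def)

lemma L2_inner_zero_left [simp]: "L2_inner (\<lambda>_. 0) h = 0"
  by (simp add: L2_inner_def)

lemma L2_norm_zero [simp]: "L2_norm (\<lambda>_. 0) = 0"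
  by (simp add: L2_norm_def)

lemma L2_C2_nontrivial: "\<exists>g\<in>L2_C2. L2_norm g > 0"
proof -
  define S :: "(complex \<times> complex) set" where "S = ball 0 1"
  have S: "S \<in> lmeasurable"
    unfolding S_def by simp
  have pos: "measure lebesgue S > 0"
    unfolding S_def using content_ball_pos[of 1 "0 :: complex \<times> complex"] by simp
  let ?g = "indicator S :: complex \<times> complex \<Rightarrow> complex"
  \<comment> \<open>An indicator is its own squared modulus, so integrability and norm both reduce
    to the measure of the unit ball, which is finite and positive.\<close>
  have sq: "(\<lambda>z. (cmod (?g z))\<^sup>2) = indicat_real S"
    by (auto simp: indicator_def fun_eq_iff)
  have "?g \<in> L2_C2"
    using S unfolding L2_C2_def sq mem_Collect_eq by (auto simp: fmeasurable_def)
  moreover have "L2_norm ?g > 0"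
    using pos S unfolding L2_norm_def sq by simp
  ultimately show ?thesis by blast
qed

section \<open>Frame bounds and best frame bounds in the complex Hilbert space\<close>

lemma frame_boundsD:
  assumes "frame_bounds F A B"
  shows "F n \<in> L2_C2" "0 < A" "A \<le> B"
    and "g \<in> L2_C2 \<Longrightarrow> summable (\<lambda>n. (cmod (L2_inner g (F n)))\<^sup>2)"
    and "g \<in> L2_C2 \<Longrightarrow> A * (L2_norm g)\<^sup>2 \<le> (\<Sum>n. (cmod (L2_inner g (F n)))\<^sup>2)"
    and "g \<in> L2_C2 \<Longrightarrow> (\<Sum>n. (cmod (L2_inner g (F n)))\<^sup>2) \<le> B * (L2_norm g)\<^sup>2"
  using assms by (simp_all add: frame_bounds_def)

lemma frame_bounds_mono:
  assumes ab: "frame_bounds F a b" and "0 < A" "A \<le> a" "b \<le> B"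
  shows "frame_bounds F A B"
  unfolding frame_bounds_def
proof (intro conjI allI ballI)
  show "A \<le> B"
    using frame_boundsD(3)[OF ab] assms by linarith
  fix g assume g: "g \<in> L2_C2"
  have "A * (L2_norm g)\<^sup>2 \<le> a * (L2_norm g)\<^sup>2" "b * (L2_norm g)\<^sup>2 \<le> B * (L2_norm g)\<^sup>2"
    using assms by (auto intro: mult_right_mono)
  then show "A * (L2_norm g)\<^sup>2 \<le> (\<Sum>n. (cmod (L2_inner g (F n)))\<^sup>2)"
    "(\<Sum>n. (cmod (L2_inner g (F n)))\<^sup>2) \<le> B * (L2_norm g)\<^sup>2"
    using frame_boundsD(5,6)[OF ab g] by linarith+
qed (simp_all add: assms frame_boundsD(1,4)[OF ab])

text \<open>Enlarging the enclosing interval preserves the frame inequalities, so the best pair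
  determines all pairs; \<open>A \<le> B\<close> comes through \<open>a \<le> b\<close>.\<close>

lemma best_frame_bounds_iff:
  assumes "best_frame_bounds F a b"
  shows "frame_bounds F A B \<longleftrightarrow> 0 < A \<and> A \<le> a \<and> b \<le> B"
proof
  assume AB: "frame_bounds F A B"
  then have "0 < A"
    by (simp add: frame_bounds_def)
  with AB assms show "0 < A \<and> A \<le> a \<and> b \<le> B"
    unfolding best_frame_bounds_def by blast
next
  assume "0 < A \<and> A \<le> a \<and> b \<le> B"
  with assms show "frame_bounds F A B"
    unfolding best_frame_bounds_def by (blast intro: frame_bounds_mono)
qed

text \<open>The two constants come from different pairs, so the definition does not compare them.
  The frame sum of one function of positive norm lies between both multiples of its squared
  norm.\<close>

lemma frame_bounds_lower_le_upper:
  assumes "frame_bounds F A B" "frame_bounds F A' B'"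
  shows "A \<le> B'"
proof -
  obtain g where g: "g \<in> L2_C2" "L2_norm g > 0"
    using L2_C2_nontrivial by blast
  have "A * (L2_norm g)\<^sup>2 \<le> (\<Sum>n. (cmod (L2_inner g (F n)))\<^sup>2)"
    using frame_boundsD(5)[OF assms(1) g(1)] .
  also have "\<dots> \<le> B' * (L2_norm g)\<^sup>2"
    using frame_boundsD(6)[OF assms(2) g(1)] .
  finally show ?thesis
    using g(2) by simp
qed

lemma is_frame_imp_best_frame_bounds:
  assumes "is_frame F"
  shows "\<exists>a b. best_frame_bounds F a b"
proof -
  obtain A0 B0 where AB0: "frame_bounds F A0 B0"
    using assms unfolding is_frame_def by blast
  \<comment> \<open>Lower and upper bounds are optimised independently; every element of
    \<open>L\<close> is at most every element of \<open>U\<close>, which bounds both sets.\<close>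
  define L where "L = {A. \<exists>B. frame_bounds F A B}"
  define U where "U = {B. \<exists>A. frame_bounds F A B}"
  have A0: "A0 \<in> L" and B0: "B0 \<in> U"
    using AB0 unfolding L_def U_def by auto
  have LU: "A \<le> B" if "A \<in> L" "B \<in> U" for A B
    using that frame_bounds_lower_le_upper unfolding L_def U_def by blast
  have bddL: "bdd_above L" and bddU: "bdd_below U"
    using LU A0 B0 unfolding bdd_above_def bdd_below_def by blast+
  have "Sup L \<le> Inf U"
    using A0 B0 LU by (intro cSup_least cInf_greatest) auto
  moreover have "0 < Sup L"
    using frame_boundsD(2)[OF AB0] cSup_upper[OF A0 bddL] by linarith
  moreover have "Sup L * (L2_norm g)\<^sup>2 \<le> (\<Sum>n. (cmod (L2_inner g (F n)))\<^sup>2)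
      \<and> (\<Sum>n. (cmod (L2_inner g (F n)))\<^sup>2) \<le> Inf U * (L2_norm g)\<^sup>2" (is "_ \<le> ?S \<and> _")
    if g: "g \<in> L2_C2" for g
  \<comment> \<open>The quotient used below does not make sense for norm zero; there the bounds
    \<open>A0\<close> and \<open>B0\<close> force the frame sum to vanish.\<close>
  proof (cases "L2_norm g = 0")
    case True
    then show ?thesis
      using frame_boundsD(5,6)[OF AB0 g] by simp
  next
    case False
    then have n: "(L2_norm g)\<^sup>2 > 0" by simp
    \<comment> \<open>For fixed \<open>g\<close> the quotient of frame sum and squared norm is an
      upper bound of \<open>L\<close> and a lower bound of \<open>U\<close>, so the inequalities
      pass to the supremum and the infimum.\<close>
    have "Sup L \<le> ?S / (L2_norm g)\<^sup>2"
      using A0 n g unfolding L_def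
      by (intro cSup_least) (auto simp: pos_le_divide_eq dest: frame_boundsD(5))
    moreover have "?S / (L2_norm g)\<^sup>2 \<le> Inf U"
      using B0 n g unfolding U_def
      by (intro cInf_greatest) (auto simp: pos_divide_le_eq dest: frame_boundsD(6))
    ultimately show ?thesis
      using n by (simp add: pos_le_divide_eq pos_divide_le_eq)
  qed
  ultimately have "frame_bounds F (Sup L) (Inf U)"
    using AB0 by (simp add: frame_bounds_def)
  moreover have "A' \<le> Sup L \<and> Inf U \<le> B'" if "frame_bounds F A' B'" for A' B'
    using that cSup_upper[OF _ bddL] cInf_lower[OF _ bddU] unfolding L_def U_def by blast
  ultimately show ?thesis
    unfolding best_frame_bounds_def by blast
qed

section \<open>Transfer between bicomplex and component frames\<close>

lemma bc_frame_bounds_iff: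
  assumes f: "\<And>n. f n \<in> L2_bc"
  shows "bc_frame_bounds f A B \<longleftrightarrow>
    frame_bounds (\<lambda>n. fun_plus (f n)) A B \<and> frame_bounds (\<lambda>n. fun_minus (f n)) A B"
proof
  assume bc: "bc_frame_bounds f A B"
  have fpm: "fun_plus (f n) \<in> L2_C2" "fun_minus (f n) \<in> L2_C2" for n
    using f unfolding L2_bc_def by auto
  have AB: "0 < A" "A \<le> B"
    using bc unfolding bc_frame_bounds_def by auto
  have frm: "summable (\<lambda>n. (bc_mod (bc_inner (bc_fun g h) (f n)))\<^sup>2) \<and>
      A * (bc_norm (bc_fun g h))\<^sup>2 \<le> (\<Sum>n. (bc_mod (bc_inner (bc_fun g h) (f n)))\<^sup>2) \<and>
      (\<Sum>n. (bc_mod (bc_inner (bc_fun g h) (f n)))\<^sup>2) \<le> B * (bc_norm (bc_fun g h))\<^sup>2"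
    if "g \<in> L2_C2" "h \<in> L2_C2" for g h
  proof -
    have "bc_fun g h \<in> L2_bc" using that by (simp add: L2_bc_def)
    then show ?thesis using bc unfolding bc_frame_bounds_def by blast
  qed
  \<comment> \<open>With one component zero, the frame sum and the squared norm both carry the
    factor 1/2 of the bicomplex modulus and norm; it cancels. Summability of \<open>s\<close> comes
    first, so that the factor can leave the series.\<close>
  have half: "summable s \<and> A * c \<le> suminf s \<and> suminf s \<le> B * c"
    if "summable (\<lambda>n. s n / 2) \<and> A * (c / 2) \<le> (\<Sum>n. s n / 2) \<and> (\<Sum>n. s n / 2) \<le> B * (c / 2)"
    for s :: "nat \<Rightarrow> real" and c
  proof -
    have "summable s"
      using that summable_mult[of "\<lambda>n. s n / 2" 2] by simp
    then show ?thesis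
      using that by (simp add: suminf_divide)
  qed
  have plus: "summable (\<lambda>n. (cmod (L2_inner g (fun_plus (f n))))\<^sup>2) \<and>
      A * (L2_norm g)\<^sup>2 \<le> (\<Sum>n. (cmod (L2_inner g (fun_plus (f n))))\<^sup>2) \<and>
      (\<Sum>n. (cmod (L2_inner g (fun_plus (f n))))\<^sup>2) \<le> B * (L2_norm g)\<^sup>2"
    if g: "g \<in> L2_C2" for g
    using frm[OF g zero_in_L2_C2]
    by - (rule half, simp add: bc_mod_bc_inner_squared bc_norm_squared)
  have minus: "summable (\<lambda>n. (cmod (L2_inner g (fun_minus (f n))))\<^sup>2) \<and>
      A * (L2_norm g)\<^sup>2 \<le> (\<Sum>n. (cmod (L2_inner g (fun_minus (f n))))\<^sup>2) \<and>
      (\<Sum>n. (cmod (L2_inner g (fun_minus (f n))))\<^sup>2) \<le> B * (L2_norm g)\<^sup>2"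
    if g: "g \<in> L2_C2" for g
    using frm[OF zero_in_L2_C2 g]
    by - (rule half, simp add: bc_mod_bc_inner_squared bc_norm_squared)
  show "frame_bounds (\<lambda>n. fun_plus (f n)) A B \<and> frame_bounds (\<lambda>n. fun_minus (f n)) A B"
    by (simp add: frame_bounds_def fpm AB plus minus)
next
  assume fr: "frame_bounds (\<lambda>n. fun_plus (f n)) A B \<and> frame_bounds (\<lambda>n. fun_minus (f n)) A B"
  have "summable (\<lambda>n. (bc_mod (bc_inner g (f n)))\<^sup>2) \<and>
        A * (bc_norm g)\<^sup>2 \<le> (\<Sum>n. (bc_mod (bc_inner g (f n)))\<^sup>2) \<and>
        (\<Sum>n. (bc_mod (bc_inner g (f n)))\<^sup>2) \<le> B * (bc_norm g)\<^sup>2"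
    if g: "g \<in> L2_bc" for g
  proof -
    define p where "p n = (cmod (L2_inner (fun_plus g) (fun_plus (f n))))\<^sup>2" for n
    define m where "m n = (cmod (L2_inner (fun_minus g) (fun_minus (f n))))\<^sup>2" for n
    have p: "summable p" "A * (L2_norm (fun_plus g))\<^sup>2 \<le> suminf p"
        "suminf p \<le> B * (L2_norm (fun_plus g))\<^sup>2"
      and m: "summable m" "A * (L2_norm (fun_minus g))\<^sup>2 \<le> suminf m"
        "suminf m \<le> B * (L2_norm (fun_minus g))\<^sup>2"
      using frame_boundsD(4-6)[OF conjunct1[OF fr]] frame_boundsD(4-6)[OF conjunct2[OF fr]] g
      unfolding L2_bc_def p_def m_def by simp_all
    have eq: "(\<lambda>n. (bc_mod (bc_inner g (f n)))\<^sup>2) = (\<lambda>n. (p n + m n) / 2)"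
      by (simp add: bc_mod_bc_inner_squared p_def m_def)
    \<comment> \<open>Both component series converge, so the sum of the averages is the average of
      the sums, and the two component inequalities can be averaged.\<close>
    have "(\<lambda>n. (p n + m n) / 2) sums ((suminf p + suminf m) / 2)"
      using p(1) m(1) by (intro sums_divide sums_add summable_sums)
    then show ?thesis
      using p m unfolding eq bc_norm_squared
      by (auto simp: sums_iff distrib_left)
  qed
  then show "bc_frame_bounds f A B"
    using f frame_boundsD(2,3)[OF conjunct1[OF fr]] by (simp add: bc_frame_bounds_def)
qed

lemma best_bc_frame_bounds_unique:
  assumes "best_bc_frame_bounds f A B" "best_bc_frame_bounds f A' B'"
  shows "A = A' \<and> B = B'"
  using assms unfolding best_bc_frame_bounds_def by (meson order_antisym)

lemma best_bc_frame_bounds_min_max: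
  assumes "\<And>n. f n \<in> L2_bc"
    and "best_frame_bounds (\<lambda>n. fun_plus (f n)) ap bp"
    and "best_frame_bounds (\<lambda>n. fun_minus (f n)) am bm"
  shows "best_bc_frame_bounds f (min ap am) (max bp bm)"
proof -
  have iff: "bc_frame_bounds f A B \<longleftrightarrow> 0 < A \<and> A \<le> min ap am \<and> max bp bm \<le> B" for A B
    using bc_frame_bounds_iff[of f, OF assms(1)] best_frame_bounds_iff[OF assms(2)]
      best_frame_bounds_iff[OF assms(3)] by auto
  \<comment> \<open>Positivity makes the candidate pair itself admissible in \<open>iff\<close>; its
    optimality can then be read off from \<open>iff\<close>.\<close>
  have "0 < min ap am"
    using assms(2,3) unfolding best_frame_bounds_def frame_bounds_def by simp
  then show ?thesis
    unfolding best_bc_frame_bounds_def iff by simp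
qed

lemma is_bc_frame_iff:
  assumes f: "\<And>n. f n \<in> L2_bc"
  shows "is_bc_frame f \<longleftrightarrow>
    is_frame (\<lambda>n. fun_plus (f n)) \<and> is_frame (\<lambda>n. fun_minus (f n))"
proof
  assume "is_bc_frame f"
  then show "is_frame (\<lambda>n. fun_plus (f n)) \<and> is_frame (\<lambda>n. fun_minus (f n))"
    using bc_frame_bounds_iff[of f, OF f] unfolding is_bc_frame_def is_frame_def by blast
next
  assume "is_frame (\<lambda>n. fun_plus (f n)) \<and> is_frame (\<lambda>n. fun_minus (f n))"
  then show "is_bc_frame f"
    \<comment> \<open>The components may come with different bounds, whereas
      \<open>bc_frame_bounds_iff\<close> needs a common pair; the minimum and maximum of the best
      bounds provide one.\<close>
    using is_frame_imp_best_frame_bounds best_bc_frame_bounds_min_max[of f, OF f]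
    unfolding is_bc_frame_def best_bc_frame_bounds_def by metis
qed

theorem theorem3p8:
  fixes f :: "nat \<Rightarrow> bicomplex \<Rightarrow> bicomplex"
  assumes "\<And>n. f n \<in> L2_bc"
  shows "(is_bc_frame f \<longleftrightarrow>
            is_frame (\<lambda>n. fun_plus (f n)) \<and> is_frame (\<lambda>n. fun_minus (f n))) \<and>
         (is_bc_frame f \<longrightarrow> (\<exists>A B. best_bc_frame_bounds f A B)) \<and>
         (\<forall>A B. best_bc_frame_bounds f A B \<longleftrightarrow>
            (\<exists>ap bp am bm.
               best_frame_bounds (\<lambda>n. fun_plus (f n)) ap bp \<and>
               best_frame_bounds (\<lambda>n. fun_minus (f n)) am bm \<and>
               A = min ap am \<and> B = max bp bm)) \<and>
         (\<forall>A B ap bp am bm.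
            best_bc_frame_bounds f A B \<longrightarrow>
            best_frame_bounds (\<lambda>n. fun_plus (f n)) ap bp \<longrightarrow>
            best_frame_bounds (\<lambda>n. fun_minus (f n)) am bm \<longrightarrow>
            A = min ap am \<and> B = max bp bm)"
proof -
  \<comment> \<open>The component bounds cannot be recovered from \<open>A\<close> and
    \<open>B\<close>, since min and max lose information. They are obtained from existence of best
    bounds, and uniqueness then identifies \<open>A\<close> and \<open>B\<close>.\<close>
  have components: "\<exists>ap bp am bm. best_frame_bounds (\<lambda>n. fun_plus (f n)) ap bp \<and>
      best_frame_bounds (\<lambda>n. fun_minus (f n)) am bm" if "is_bc_frame f"
    using that is_frame_imp_best_frame_bounds is_bc_frame_iff[of f, OF assms] by blast
  have min_max: "A = min ap am \<and> B = max bp bm"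
    if "best_bc_frame_bounds f A B" "best_frame_bounds (\<lambda>n. fun_plus (f n)) ap bp"
      "best_frame_bounds (\<lambda>n. fun_minus (f n)) am bm" for A B ap bp am bm
    using that best_bc_frame_bounds_min_max[of f, OF assms] best_bc_frame_bounds_unique by blast
  have frame: "is_bc_frame f" if "best_bc_frame_bounds f A B" for A B
    using that unfolding best_bc_frame_bounds_def is_bc_frame_def by blast
  show ?thesis
  proof (intro conjI allI)
    show "is_bc_frame f \<longleftrightarrow>
        is_frame (\<lambda>n. fun_plus (f n)) \<and> is_frame (\<lambda>n. fun_minus (f n))"
      by (rule is_bc_frame_iff[of f, OF assms])
    show "is_bc_frame f \<longrightarrow> (\<exists>A B. best_bc_frame_bounds f A B)"
      using components best_bc_frame_bounds_min_max[of f, OF assms] by blast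
    show "best_bc_frame_bounds f A B \<longleftrightarrow>
        (\<exists>ap bp am bm. best_frame_bounds (\<lambda>n. fun_plus (f n)) ap bp \<and>
          best_frame_bounds (\<lambda>n. fun_minus (f n)) am bm \<and> A = min ap am \<and> B = max bp bm)" for A B
      using components[OF frame] min_max best_bc_frame_bounds_min_max[of f, OF assms] by metis
  qed (use min_max in blast)
qed

end
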